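(* Let $\mathcal{X}$ and $\mathcal{Y}$ be Riemannian manifolds, let $\mathcal{A}=L^2(\mathcal{X};\mathbb{R})$ and $\mathcal{U}=L^2(\mathcal{Y};\mathbb{R})$, and let $(\phi_{\mathcal{X},i})_{i\ge 1}$ and $(\phi_{\mathcal{Y},i})_{i\ge 1}$ be the Laplace--Beltrami eigenfunctions of $\mathcal{X}$ and $\mathcal{Y}$, which form orthonormal bases of $\mathcal{A}$ and $\mathcal{U}$ respectively. For all $m,n\in\mathbb{N}$ let $\mathcal{F}_{m,n}\subseteq C(\mathbb{R}^m,\mathbb{R}^n)$ be a class of neural networks having the universal approximation property. Let $\mathcal{G}:\mathcal{A}\to\mathcal{U}$ be a Lipschitz continuous operator and let $K\subset\mathcal{A}$ be a compact set. Then for every $\epsilon>0$ there exists a neural operator $\mathcal{N}=\mathcal{D}\circ\mathcal{R}\circ\mathcal{E}:\mathcal{A}\to\mathcal{U}$, that is, there exist $d_{\mathcal{X}},d_{\mathcal{Y}}\in\mathbb{N}$ and a network $\mathcal{R}\in\mathcal{F}_{d_{\mathcal{X}},d_{\mathcal{Y}}}$, with $$\mathcal{E}:\mathcal{A}\to\mathbb{R}^{d_{\mathcal{X}}},\quad \mathcal{E}(a)=\big(\langle a,\phi_{\mathcal{X},1}\rangle,\ldots,\langle a,\phi_{\mathcal{X},d_{\mathcal{X}}}\rangle\big),\qquad \mathcal{D}:\mathbb{R}^{d_{\mathcal{Y}}}\to\mathcal{U},\quad \mathcal{D}(\beta)=\sum_{i=1}^{d_{\mathcal{Y}}}\beta_i\,\phi_{\mathcal{Y},i},$$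 such that $$\sup_{a\in K}\|\mathcal{G}(a)-\mathcal{N}(a)\|_{L^2}\le\epsilon .$$
   Context: For a Riemannian manifold $\mathcal{M}$, $L^2(\mathcal{M};\mathbb{R})$ is taken with respect to the Riemannian volume measure, with inner product $\langle\cdot,\cdot\rangle$ and norm $\|\cdot\|_{L^2}$. The Laplace--Beltrami operator (LBO) $\Delta$ of $\mathcal{M}$ is the Laplacian (divergence of gradient) on $\mathcal{M}$, with sign chosen so that its eigenvalues are listed in ascending order. Its eigenfunctions $\phi_{\mathcal{M},i}$ satisfy $\Delta\phi_{\mathcal{M},i}=\lambda_i\phi_{\mathcal{M},i}$ with $\lambda_1\le\lambda_2\le\cdots$. Standing assumption: for the manifolds considered, the LBO eigenfunctions $(\phi_{\mathcal{M},i})_{i\ge1}$ form an orthonormal basis of the Hilbert space $L^2(\mathcal{M};\mathbb{R})$ (as is the case, for example, for compact manifolds). Lipschitz continuity of $\mathcal{G}$ means that there is a constant $M>0$ with $\|\mathcal{G}(a_1)-\mathcal{G}(a_2)\|_{L^2}\le M\|a_1-a_2\|_{L^2}$ for all $a_1,a_2\in\mathcal{A}$. A class of neural networks $\mathcal{F}_{m,n}\subseteq C(\mathbb{R}^m,\mathbb{R}^n)$ has the universal approximation property if it is dense in $C(\mathbb{R}^m,\mathbb{R}^n)$ for the topology of uniform convergence on compact sets: for every $f\in C(\mathbb{R}^m,\mathbb{R}^n)$, every compact $C\subset\mathbb{R}^m$ and every $\delta>0$ there is $g\in\mathcal{F}_{m,n}$ with $\sup_{x\in C}\|f(x)-g(x)\|\le\delta$.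 *)

theory Defs
  imports "HOL-Analysis.Analysis" "Jordan_Normal_Form.Determinant"
    "Jordan_Normal_Form.Gauss_Jordan_Elimination"
begin

section \<open>Calculus on open subsets of Euclidean space\<close>

text \<open>Points of \<open>\<real>\<^sup>n\<close> are the points of \<^const>\<open>Euclidean_space\<close> \<open>n\<close>, i.e. functions
  \<open>u :: nat \<Rightarrow> real\<close> with \<open>u i = 0\<close> for \<open>i \<ge> n\<close>; coordinates are numbered \<open>0, \<dots>, n - 1\<close>.\<close>

definition partial_deriv :: "nat \<Rightarrow> ((nat \<Rightarrow> real) \<Rightarrow> real) \<Rightarrow> (nat \<Rightarrow> real) \<Rightarrow> real" where
  "partial_deriv i f u = deriv (\<lambda>t. f (u(i := t))) (u i)"

text \<open>\<open>C\<^sup>\<infinity>\<close> on the open set \<open>W \<subseteq> \<real>\<^sup>n\<close>: all iterated partial derivatives exist and are continuous.\<close>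

definition smooth_on :: "nat \<Rightarrow> (nat \<Rightarrow> real) set \<Rightarrow> ((nat \<Rightarrow> real) \<Rightarrow> real) \<Rightarrow> bool" where
  "smooth_on n W f \<longleftrightarrow>
     (\<forall>js. set js \<subseteq> {..<n} \<longrightarrow>
        continuous_map (subtopology (Euclidean_space n) W) euclideanreal (foldr partial_deriv js f) \<and>
        (\<forall>u\<in>W. \<forall>i<n. (\<lambda>t. foldr partial_deriv js f (u(i := t))) differentiable (at (u i))))"

definition lebesgue_Rn :: "nat \<Rightarrow> (nat \<Rightarrow> real) measure" where
  "lebesgue_Rn n = distr (\<Pi>\<^sub>M i\<in>{..<n}. lborel) borel (\<lambda>v i. if i < n then v i else 0)"

section \<open>Riemannian manifolds\<close>

type_synonym 'a chart = "'a set \<times> ('a \<Rightarrow> nat \<Rightarrow> real)"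

text \<open>The metric tensor is given by its components: for a chart \<open>c = (U, x)\<close> and \<open>p \<in> U\<close>,
  \<open>metric M c p i j\<close> is \<open>g\<^sub>p(\<partial>/\<partial>x\<^sub>i, \<partial>/\<partial>x\<^sub>j)\<close>.\<close>

record 'a manifold =
  mtop :: "'a topology"
  mdim :: nat
  charts :: "'a chart set"
  metric :: "'a chart \<Rightarrow> 'a \<Rightarrow> nat \<Rightarrow> nat \<Rightarrow> real"

definition chart_inv :: "'a chart \<Rightarrow> (nat \<Rightarrow> real) \<Rightarrow> 'a" where
  "chart_inv c = inv_into (fst c) (snd c)"

definition transition :: "'a chart \<Rightarrow> 'a chart \<Rightarrow> nat \<Rightarrow> (nat \<Rightarrow> real) \<Rightarrow> real" where
  "transition c d k u = snd d (chart_inv c u) k"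

definition topological_chart :: "'a topology \<Rightarrow> nat \<Rightarrow> 'a chart \<Rightarrow> bool" where
  "topological_chart T n c \<longleftrightarrow>
     openin T (fst c) \<and> openin (Euclidean_space n) (snd c ` fst c) \<and>
     homeomorphic_map (subtopology T (fst c)) (subtopology (Euclidean_space n) (snd c ` fst c)) (snd c)"

definition smooth_manifold :: "'a manifold \<Rightarrow> bool" where
  "smooth_manifold M \<longleftrightarrow>
     Hausdorff_space (mtop M) \<and> second_countable (mtop M) \<and>
     (\<forall>c\<in>charts M. topological_chart (mtop M) (mdim M) c) \<and>
     (\<Union>c\<in>charts M. fst c) = topspace (mtop M) \<and>
     (\<forall>c\<in>charts M. \<forall>d\<in>charts M. \<forall>k<mdim M.
        smooth_on (mdim M) (snd c ` (fst c \<inter> fst d)) (transition c d k))"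

definition jacobian :: "'a chart \<Rightarrow> 'a chart \<Rightarrow> 'a \<Rightarrow> nat \<Rightarrow> nat \<Rightarrow> real" where
  "jacobian c d p k i = partial_deriv i (transition c d k) (snd c p)"

text \<open>The last conjunct is the transformation law of a covariant tensor of rank two.\<close>

definition riemannian_manifold :: "'a manifold \<Rightarrow> bool" where
  "riemannian_manifold M \<longleftrightarrow> smooth_manifold M \<and>
     (\<forall>c\<in>charts M. \<forall>i<mdim M. \<forall>j<mdim M.
        smooth_on (mdim M) (snd c ` fst c) (\<lambda>u. metric M c (chart_inv c u) i j)) \<and>
     (\<forall>c\<in>charts M. \<forall>p\<in>fst c. \<forall>i<mdim M. \<forall>j<mdim M. metric M c p i j = metric M c p j i) \<and>
     (\<forall>c\<in>charts M. \<forall>p\<in>fst c. \<forall>v. (\<exists>i<mdim M. v i \<noteq> 0) \<longrightarrow>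
        (\<Sum>i<mdim M. \<Sum>j<mdim M. metric M c p i j * v i * v j) > 0) \<and>
     (\<forall>c\<in>charts M. \<forall>d\<in>charts M. \<forall>p\<in>fst c \<inter> fst d. \<forall>i<mdim M. \<forall>j<mdim M.
        metric M c p i j =
          (\<Sum>k<mdim M. \<Sum>l<mdim M. metric M d p k l * jacobian c d p k i * jacobian c d p l j))"

definition metric_mat :: "'a manifold \<Rightarrow> 'a chart \<Rightarrow> 'a \<Rightarrow> real mat" where
  "metric_mat M c p = Matrix.mat (mdim M) (mdim M) (\<lambda>(i, j). metric M c p i j)"

definition volume_density :: "'a manifold \<Rightarrow> 'a chart \<Rightarrow> (nat \<Rightarrow> real) \<Rightarrow> real" where
  "volume_density M c u = sqrt (Determinant.det (metric_mat M c (chart_inv c u)))"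

text \<open>The chart formula determines the measure, because countably many chart domains cover \<open>M\<close>.\<close>

definition riemannian_volume :: "'a manifold \<Rightarrow> 'a measure" where
  "riemannian_volume M = (THE \<mu>.
     space \<mu> = topspace (mtop M) \<and>
     sets \<mu> = sigma_sets (topspace (mtop M)) {U. openin (mtop M) U} \<and>
     (\<forall>c\<in>charts M. \<forall>A\<in>sets \<mu>. A \<subseteq> fst c \<longrightarrow>
        emeasure \<mu> A = (\<integral>\<^sup>+u\<in>snd c ` A. ennreal (volume_density M c u) \<partial>lebesgue_Rn (mdim M))))"

section \<open>The Laplace--Beltrami operator\<close>

definition smooth_function :: "'a manifold \<Rightarrow> ('a \<Rightarrow> real) \<Rightarrow> bool" where
  "smooth_function M f \<longleftrightarrow>
     (\<forall>c\<in>charts M. smooth_on (mdim M) (snd c ` fst c) (f \<circ> chart_inv c))"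

text \<open>Gradient and divergence in the coordinates of the chart \<open>c\<close>.\<close>

definition grad_in_chart ::
    "'a manifold \<Rightarrow> 'a chart \<Rightarrow> ('a \<Rightarrow> real) \<Rightarrow> nat \<Rightarrow> (nat \<Rightarrow> real) \<Rightarrow> real" where
  "grad_in_chart M c f i u =
     (\<Sum>j<mdim M. the (mat_inverse (metric_mat M c (chart_inv c u))) $$ (i, j)
        * partial_deriv j (f \<circ> chart_inv c) u)"

definition div_in_chart ::
    "'a manifold \<Rightarrow> 'a chart \<Rightarrow> (nat \<Rightarrow> (nat \<Rightarrow> real) \<Rightarrow> real) \<Rightarrow> (nat \<Rightarrow> real) \<Rightarrow> real" where
  "div_in_chart M c V u =
     (\<Sum>i<mdim M. partial_deriv i (\<lambda>w. volume_density M c w * V i w) u) / volume_density M c u"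

text \<open>The sign makes the operator non-negative on compact manifolds.\<close>

definition laplace_beltrami :: "'a manifold \<Rightarrow> 'a chart \<Rightarrow> ('a \<Rightarrow> real) \<Rightarrow> 'a \<Rightarrow> real" where
  "laplace_beltrami M c f p = - div_in_chart M c (grad_in_chart M c f) (snd c p)"

section \<open>The Hilbert space \<open>L\<^sup>2(\<mu>; \<real>)\<close>\<close>

definition square_integrable :: "'a measure \<Rightarrow> ('a \<Rightarrow> real) set" where
  "square_integrable \<mu> = {f \<in> borel_measurable \<mu>. integrable \<mu> (\<lambda>x. (f x)\<^sup>2)}"

definition ae_eq :: "'a measure \<Rightarrow> (('a \<Rightarrow> real) \<times> ('a \<Rightarrow> real)) set" where
  "ae_eq \<mu> = {(f, g). f \<in> square_integrable \<mu> \<and> g \<in> square_integrable \<mu> \<and> (AE x in \<mu>. f x = g x)}"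

definition L2 :: "'a measure \<Rightarrow> ('a \<Rightarrow> real) set set" where
  "L2 \<mu> = square_integrable \<mu> // ae_eq \<mu>"

definition L2_class :: "'a measure \<Rightarrow> ('a \<Rightarrow> real) \<Rightarrow> ('a \<Rightarrow> real) set" where
  "L2_class \<mu> f = ae_eq \<mu> `` {f}"

definition L2_rep :: "('a \<Rightarrow> real) set \<Rightarrow> 'a \<Rightarrow> real" where
  "L2_rep a = (SOME f. f \<in> a)"

definition L2_inner :: "'a measure \<Rightarrow> ('a \<Rightarrow> real) set \<Rightarrow> ('a \<Rightarrow> real) set \<Rightarrow> real" where
  "L2_inner \<mu> a b = (\<integral>x. L2_rep a x * L2_rep b x \<partial>\<mu>)"

definition L2_norm :: "'a measure \<Rightarrow> ('a \<Rightarrow> real) set \<Rightarrow> real" where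
  "L2_norm \<mu> a = sqrt (L2_inner \<mu> a a)"

definition L2_diff ::
    "'a measure \<Rightarrow> ('a \<Rightarrow> real) set \<Rightarrow> ('a \<Rightarrow> real) set \<Rightarrow> ('a \<Rightarrow> real) set" where
  "L2_diff \<mu> a b = L2_class \<mu> (\<lambda>x. L2_rep a x - L2_rep b x)"

definition L2_topology :: "'a measure \<Rightarrow> ('a \<Rightarrow> real) set topology" where
  "L2_topology \<mu> = Metric_space.mtopology (L2 \<mu>) (\<lambda>a b. L2_norm \<mu> (L2_diff \<mu> a b))"

subsection \<open>The norm distance is a metric\<close>

lemma square_integrable_prod:
  assumes "f \<in> square_integrable \<mu>" "g \<in> square_integrable \<mu>"
  shows "integrable \<mu> (\<lambda>x. f x * g x)"
proof (rule Bochner_Integration.integrable_bound)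
  show "integrable \<mu> (\<lambda>x. (f x)\<^sup>2 + (g x)\<^sup>2)"
    using assms by (auto simp: square_integrable_def)
  show "(\<lambda>x. f x * g x) \<in> borel_measurable \<mu>"
    using assms by (auto simp: square_integrable_def)
  have "\<bar>a * b\<bar> \<le> \<bar>a\<^sup>2 + b\<^sup>2\<bar>" for a b :: real
  proof -
    have "(\<bar>a\<bar> - \<bar>b\<bar>)\<^sup>2 \<ge> 0" by simp
    hence "2 * (\<bar>a\<bar> * \<bar>b\<bar>) \<le> a\<^sup>2 + b\<^sup>2" by (simp add: power2_diff)
    moreover have "\<bar>a\<bar> * \<bar>b\<bar> \<ge> 0" by simp
    ultimately show ?thesis unfolding abs_mult by linarith
  qed
  thus "AE x in \<mu>. norm (f x * g x) \<le> norm ((f x)\<^sup>2 + (g x)\<^sup>2)" by simp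
qed

lemma square_integrable_diff:
  assumes "f \<in> square_integrable \<mu>" "g \<in> square_integrable \<mu>"
  shows "(\<lambda>x. f x - g x) \<in> square_integrable \<mu>"
proof -
  have "integrable \<mu> (\<lambda>x. (f x)\<^sup>2 + (g x)\<^sup>2 - 2 * (f x * g x))"
    using assms square_integrable_prod[OF assms]
    by (intro Bochner_Integration.integrable_diff Bochner_Integration.integrable_add integrable_mult_right)
       (auto simp: square_integrable_def)
  thus ?thesis using assms by (auto simp: square_integrable_def power2_diff mult.assoc)
qed

lemma equiv_ae_eq: "equiv (square_integrable \<mu>) (ae_eq \<mu>)"
proof (rule equivI)
  show "ae_eq \<mu> \<subseteq> square_integrable \<mu> \<times> square_integrable \<mu>" by (auto simp: ae_eq_def)
  show "refl_on (square_integrable \<mu>) (ae_eq \<mu>)" by (auto simp: ae_eq_def refl_on_def)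
  show "sym (ae_eq \<mu>)" by (auto simp: ae_eq_def sym_def elim: AE_mp)
  show "trans (ae_eq \<mu>)"
  proof (rule transI)
    fix f g h assume "(f, g) \<in> ae_eq \<mu>" "(g, h) \<in> ae_eq \<mu>"
    thus "(f, h) \<in> ae_eq \<mu>" unfolding ae_eq_def by (auto elim: AE_mp)
  qed
qed

lemma L2_class_in_L2: "f \<in> square_integrable \<mu> \<Longrightarrow> L2_class \<mu> f \<in> L2 \<mu>"
  by (auto simp: L2_def L2_class_def quotient_def)

lemma L2_rep:
  assumes "a \<in> L2 \<mu>"
  shows "L2_rep a \<in> square_integrable \<mu>" "L2_class \<mu> (L2_rep a) = a"
proof -
  have "L2_rep a \<in> a"
    using in_quotient_imp_non_empty[OF equiv_ae_eq assms[unfolded L2_def]]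
    by (auto simp: L2_rep_def some_in_eq)
  thus "L2_rep a \<in> square_integrable \<mu>" "L2_class \<mu> (L2_rep a) = a"
    using assms in_quotient_imp_subset[OF equiv_ae_eq] Image_singleton_iff
      quotient_eqI[OF equiv_ae_eq] equiv_ae_eq
    unfolding L2_def L2_class_def
    by (blast, metis (no_types, lifting) equiv_class_eq_iff equiv_class_self quotientE
          Image_singleton_iff)
qed

lemma L2_class_rep:
  assumes "f \<in> square_integrable \<mu>"
  shows "AE x in \<mu>. L2_rep (L2_class \<mu> f) x = f x"
proof -
  have "ae_eq \<mu> `` {L2_rep (L2_class \<mu> f)} = ae_eq \<mu> `` {f}"
    using L2_rep(2)[OF L2_class_in_L2[OF assms]] by (simp add: L2_class_def)
  hence "(L2_rep (L2_class \<mu> f), f) \<in> ae_eq \<mu>"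
    using assms equiv_ae_eq by (meson eq_equiv_class)
  thus ?thesis by (simp add: ae_eq_def)
qed

lemma L2_inner_class:
  assumes "f \<in> square_integrable \<mu>" "g \<in> square_integrable \<mu>"
  shows "L2_inner \<mu> (L2_class \<mu> f) (L2_class \<mu> g) = (\<integral>x. f x * g x \<partial>\<mu>)"
proof -
  have sq: "L2_rep (L2_class \<mu> f) \<in> square_integrable \<mu>" "L2_rep (L2_class \<mu> g) \<in> square_integrable \<mu>"
    using assms L2_rep(1) L2_class_in_L2 by blast+
  show ?thesis unfolding L2_inner_def
  proof (rule integral_cong_AE)
    show "AE x in \<mu>. L2_rep (L2_class \<mu> f) x * L2_rep (L2_class \<mu> g) x = f x * g x"
      using L2_class_rep[OF assms(1)] L2_class_rep[OF assms(2)] by eventually_elim simp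
  qed (use sq assms in \<open>auto simp: square_integrable_def\<close>)
qed

lemma L2_dist_eq:
  assumes "a \<in> L2 \<mu>" "b \<in> L2 \<mu>"
  shows "L2_norm \<mu> (L2_diff \<mu> a b) = sqrt (\<integral>x. (L2_rep a x - L2_rep b x)\<^sup>2 \<partial>\<mu>)"
  using square_integrable_diff[OF L2_rep(1)[OF assms(1)] L2_rep(1)[OF assms(2)]]
  by (simp add: L2_norm_def L2_diff_def L2_inner_class power2_eq_square)

lemma square_integrable_Cauchy_Schwarz:
  assumes f: "f \<in> square_integrable \<mu>" and g: "g \<in> square_integrable \<mu>"
  shows "(\<integral>x. f x * g x \<partial>\<mu>) \<le> sqrt (\<integral>x. (f x)\<^sup>2 \<partial>\<mu>) * sqrt (\<integral>x. (g x)\<^sup>2 \<partial>\<mu>)"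
proof -
  define p q where "p = sqrt (\<integral>x. (f x)\<^sup>2 \<partial>\<mu>)" and "q = sqrt (\<integral>x. (g x)\<^sup>2 \<partial>\<mu>)"
  have If: "integrable \<mu> (\<lambda>x. (f x)\<^sup>2)" and Ig: "integrable \<mu> (\<lambda>x. (g x)\<^sup>2)"
    using f g by (auto simp: square_integrable_def)
  have p2: "p\<^sup>2 = (\<integral>x. (f x)\<^sup>2 \<partial>\<mu>)" and q2: "q\<^sup>2 = (\<integral>x. (g x)\<^sup>2 \<partial>\<mu>)"
    unfolding p_def q_def by simp_all
  have pq0: "p \<ge> 0" "q \<ge> 0" unfolding p_def q_def by simp_all
  show ?thesis
  proof (cases "p = 0 \<or> q = 0")
    case True
    hence "(AE x in \<mu>. (f x)\<^sup>2 = 0) \<or> (AE x in \<mu>. (g x)\<^sup>2 = 0)"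
      using p2 q2 integral_nonneg_eq_0_iff_AE[OF If] integral_nonneg_eq_0_iff_AE[OF Ig] by auto
    hence "AE x in \<mu>. f x * g x = 0" by (auto elim: AE_mp)
    hence "(\<integral>x. f x * g x \<partial>\<mu>) = 0"
      by (rule integral_eq_zero_AE)
    thus ?thesis by simp
  next
    case False
    hence pos: "p > 0" "q > 0" using pq0 by auto
    have "2 * p * q * (\<integral>x. f x * g x \<partial>\<mu>) = (\<integral>x. 2 * p * q * (f x * g x) \<partial>\<mu>)" by simp
    also have "\<dots> \<le> (\<integral>x. q\<^sup>2 * (f x)\<^sup>2 + p\<^sup>2 * (g x)\<^sup>2 \<partial>\<mu>)"
    proof (rule integral_mono)
      show "integrable \<mu> (\<lambda>x. 2 * p * q * (f x * g x))"
        using square_integrable_prod[OF f g] by simp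
      show "integrable \<mu> (\<lambda>x. q\<^sup>2 * (f x)\<^sup>2 + p\<^sup>2 * (g x)\<^sup>2)" using If Ig by simp
      show "2 * p * q * (f x * g x) \<le> q\<^sup>2 * (f x)\<^sup>2 + p\<^sup>2 * (g x)\<^sup>2" for x
        using zero_le_power2[of "q * f x - p * g x"]
        by (simp add: power2_diff power_mult_distrib algebra_simps)
    qed
    also have "\<dots> = 2 * p * q * (p * q)" using If Ig
      by (simp add: p2[symmetric] q2[symmetric]) (simp add: power2_eq_square)
    finally show ?thesis using pos unfolding p_def[symmetric] q_def[symmetric] by simp
  qed
qed

lemma Metric_space_L2: "Metric_space (L2 \<mu>) (\<lambda>a b. L2_norm \<mu> (L2_diff \<mu> a b))"
proof
  fix a b :: "('a \<Rightarrow> real) set"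
  show "0 \<le> L2_norm \<mu> (L2_diff \<mu> a b)"
    by (simp add: L2_norm_def L2_inner_def)
  have swap: "(\<lambda>x. g x - f x) \<in> square_integrable \<mu>"
    if "(\<lambda>x. f x - g x) \<in> square_integrable \<mu>" for f g :: "'a \<Rightarrow> real"
  proof -
    have "(\<lambda>x. - (f x - g x)) \<in> borel_measurable \<mu>"
      using that by (intro borel_measurable_uminus) (simp add: square_integrable_def)
    thus ?thesis using that by (simp add: square_integrable_def power2_commute)
  qed
  show "L2_norm \<mu> (L2_diff \<mu> a b) = L2_norm \<mu> (L2_diff \<mu> b a)"
  proof (cases "(\<lambda>x. L2_rep b x - L2_rep a x) \<in> square_integrable \<mu>")
    case True
    with swap[OF True] show ?thesis
      by (simp add: L2_norm_def L2_diff_def L2_inner_class algebra_simps)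
  next
    case False
    hence "(\<lambda>x. L2_rep a x - L2_rep b x) \<notin> square_integrable \<mu>"
      using swap by blast
    with False show ?thesis by (simp add: L2_diff_def L2_class_def ae_eq_def)
  qed
next
  fix a b assume ab: "a \<in> L2 \<mu>" "b \<in> L2 \<mu>"
  have sq: "L2_rep a \<in> square_integrable \<mu>" "L2_rep b \<in> square_integrable \<mu>"
    using ab L2_rep(1) by blast+
  have "L2_norm \<mu> (L2_diff \<mu> a b) = 0 \<longleftrightarrow> (AE x in \<mu>. (L2_rep a x - L2_rep b x)\<^sup>2 = 0)"
    using square_integrable_diff[OF sq]
    by (simp add: L2_dist_eq[OF ab] integral_nonneg_eq_0_iff_AE square_integrable_def)
  also have "\<dots> \<longleftrightarrow> (L2_rep a, L2_rep b) \<in> ae_eq \<mu>" using sq by (simp add: ae_eq_def)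
  also have "\<dots> \<longleftrightarrow> a = b"
    using L2_rep(2)[OF ab(1)] L2_rep(2)[OF ab(2)] eq_equiv_class_iff[OF equiv_ae_eq sq]
    by (simp add: L2_class_def)
  finally show "(L2_norm \<mu> (L2_diff \<mu> a b) = 0) = (a = b)" .
next
  fix a b c assume abc: "a \<in> L2 \<mu>" "b \<in> L2 \<mu>" "c \<in> L2 \<mu>"
  define f g where "f = (\<lambda>x. L2_rep a x - L2_rep b x)" and "g = (\<lambda>x. L2_rep b x - L2_rep c x)"
  have f: "f \<in> square_integrable \<mu>" and g: "g \<in> square_integrable \<mu>"
    unfolding f_def g_def using abc L2_rep(1) square_integrable_diff by blast+
  define p q where "p = sqrt (\<integral>x. (f x)\<^sup>2 \<partial>\<mu>)" and "q = sqrt (\<integral>x. (g x)\<^sup>2 \<partial>\<mu>)"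
  have "(\<integral>x. (L2_rep a x - L2_rep c x)\<^sup>2 \<partial>\<mu>) = (\<integral>x. (f x)\<^sup>2 + (g x)\<^sup>2 + 2 * (f x * g x) \<partial>\<mu>)"
    by (rule Bochner_Integration.integral_cong) (simp_all add: f_def g_def power2_eq_square algebra_simps)
  also have "\<dots> = p\<^sup>2 + q\<^sup>2 + 2 * (\<integral>x. f x * g x \<partial>\<mu>)"
    using f g square_integrable_prod[OF f g] by (simp add: square_integrable_def p_def q_def)
  also have "\<dots> \<le> (p + q)\<^sup>2"
    using square_integrable_Cauchy_Schwarz[OF f g] by (simp add: p_def q_def power2_sum)
  finally have "sqrt (\<integral>x. (L2_rep a x - L2_rep c x)\<^sup>2 \<partial>\<mu>) \<le> p + q"
    by (rule real_le_lsqrt[rotated]) (simp add: p_def q_def)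
  thus "L2_norm \<mu> (L2_diff \<mu> a c) \<le> L2_norm \<mu> (L2_diff \<mu> a b) + L2_norm \<mu> (L2_diff \<mu> b c)"
    using abc by (simp add: L2_dist_eq p_def q_def f_def g_def)
qed

section \<open>Orthonormal bases of Laplace--Beltrami eigenfunctions\<close>

definition L2_span :: "'a measure \<Rightarrow> (nat \<Rightarrow> 'a \<Rightarrow> real) \<Rightarrow> ('a \<Rightarrow> real) set set" where
  "L2_span \<mu> \<phi> = {L2_class \<mu> (\<lambda>x. \<Sum>i<N. c i * \<phi> i x) | N c. True}"

definition orthonormal_basis_L2 :: "'a measure \<Rightarrow> (nat \<Rightarrow> 'a \<Rightarrow> real) \<Rightarrow> bool" where
  "orthonormal_basis_L2 \<mu> \<phi> \<longleftrightarrow>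
     (\<forall>i. \<phi> i \<in> square_integrable \<mu>) \<and>
     (\<forall>i j. L2_inner \<mu> (L2_class \<mu> (\<phi> i)) (L2_class \<mu> (\<phi> j)) = (if i = j then 1 else 0)) \<and>
     L2_topology \<mu> closure_of L2_span \<mu> \<phi> = L2 \<mu>"

definition LBO_eigenbasis :: "'a manifold \<Rightarrow> (nat \<Rightarrow> real) \<Rightarrow> (nat \<Rightarrow> 'a \<Rightarrow> real) \<Rightarrow> bool" where
  "LBO_eigenbasis M ev \<phi> \<longleftrightarrow>
     mono ev \<and>
     (\<forall>i. smooth_function M (\<phi> i) \<and>
        (\<forall>c\<in>charts M. \<forall>p\<in>fst c. laplace_beltrami M c (\<phi> i) p = ev i * \<phi> i p)) \<and>
     orthonormal_basis_L2 (riemannian_volume M) \<phi>"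

section \<open>Networks and neural operators\<close>

definition C_Rn :: "nat \<Rightarrow> nat \<Rightarrow> ((nat \<Rightarrow> real) \<Rightarrow> (nat \<Rightarrow> real)) set" where
  "C_Rn m n = {f. continuous_map (Euclidean_space m) (Euclidean_space n) f}"

definition universal_approximation ::
    "nat \<Rightarrow> nat \<Rightarrow> ((nat \<Rightarrow> real) \<Rightarrow> (nat \<Rightarrow> real)) set \<Rightarrow> bool" where
  "universal_approximation m n F \<longleftrightarrow>
     (\<forall>f\<in>C_Rn m n. \<forall>C \<delta>. compactin (Euclidean_space m) C \<longrightarrow> \<delta> > 0 \<longrightarrow>
        (\<exists>g\<in>F. (SUP x\<in>C. ereal (L2_set (\<lambda>i. f x i - g x i) {..<n})) \<le> ereal \<delta>))"

definition lipschitz_operator ::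
    "'a measure \<Rightarrow> 'b measure \<Rightarrow> (('a \<Rightarrow> real) set \<Rightarrow> ('b \<Rightarrow> real) set) \<Rightarrow> bool" where
  "lipschitz_operator \<mu> \<nu> G \<longleftrightarrow>
     (\<exists>M>0. \<forall>a1\<in>L2 \<mu>. \<forall>a2\<in>L2 \<mu>.
        L2_norm \<nu> (L2_diff \<nu> (G a1) (G a2)) \<le> M * L2_norm \<mu> (L2_diff \<mu> a1 a2))"

definition encoder ::
    "'a measure \<Rightarrow> (nat \<Rightarrow> 'a \<Rightarrow> real) \<Rightarrow> nat \<Rightarrow> ('a \<Rightarrow> real) set \<Rightarrow> nat \<Rightarrow> real" where
  "encoder \<mu> \<phi> d a = (\<lambda>i. if i < d then L2_inner \<mu> a (L2_class \<mu> (\<phi> i)) else 0)"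

definition decoder ::
    "'b measure \<Rightarrow> (nat \<Rightarrow> 'b \<Rightarrow> real) \<Rightarrow> nat \<Rightarrow> (nat \<Rightarrow> real) \<Rightarrow> ('b \<Rightarrow> real) set" where
  "decoder \<nu> \<phi> d \<beta> = L2_class \<nu> (\<lambda>y. \<Sum>i<d. \<beta> i * \<phi> i y)"

end

theory Submission
  imports Defs
begin

text \<open>By compactness, truncating the basis expansions of \<open>\<A>\<close> and \<open>\<U>\<close> at suitable lengths is
  uniformly accurate on \<open>K\<close> and on \<open>\<G>(K)\<close>. Between the truncated coefficient spaces \<open>\<G>\<close> induces
  the continuous map \<open>f = \<E>\<^sub>\<Y> \<circ> \<G> \<circ> \<D>\<^sub>\<X>\<close>, which a network \<open>\<R>\<close> approximates on the compact set
  \<open>\<E>\<^sub>\<X>(K)\<close>. As encoders are non-expansive and decoders isometric, the error of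
  \<open>\<D>\<^sub>\<Y> \<circ> \<R> \<circ> \<E>\<^sub>\<X>\<close> is at most the truncation error in \<open>\<U>\<close>, plus \<open>M\<close> times the truncation error
  in \<open>\<A>\<close>, plus the network error.\<close>

section \<open>Square-integrable functions and distances of their classes\<close>

abbreviation (input) L2_dist :: "'a measure \<Rightarrow> ('a \<Rightarrow> real) set \<Rightarrow> ('a \<Rightarrow> real) set \<Rightarrow> real" where
  "L2_dist \<mu> a b \<equiv> L2_norm \<mu> (L2_diff \<mu> a b)"

lemma square_integrable_0: "(\<lambda>x. 0) \<in> square_integrable \<mu>"
  by (simp add: square_integrable_def)

lemma square_integrable_cmult:
  assumes "f \<in> square_integrable \<mu>"
  shows "(\<lambda>x. c * f x) \<in> square_integrable \<mu>"
  using assms by (auto simp: square_integrable_def power_mult_distrib)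

lemma square_integrable_add:
  assumes "f \<in> square_integrable \<mu>" "g \<in> square_integrable \<mu>"
  shows "(\<lambda>x. f x + g x) \<in> square_integrable \<mu>"
  using square_integrable_diff[OF assms(1) square_integrable_cmult[OF assms(2), of "-1"]] by simp

lemma square_integrable_lincomb:
  fixes N :: nat
  assumes "\<And>i. \<phi> i \<in> square_integrable \<mu>"
  shows "(\<lambda>x. \<Sum>i<N. c i * \<phi> i x) \<in> square_integrable \<mu>"
  by (induction N)
    (simp_all add: square_integrable_0 square_integrable_add square_integrable_cmult assms)

text \<open>The representatives picked by \<open>L2_rep\<close> agree with \<open>f\<close> and
  \<open>g\<close> almost everywhere, so distances can be computed from explicit functions.\<close>

lemma L2_dist_class:
  assumes f: "f \<in> square_integrable \<mu>" and g: "g \<in> square_integrable \<mu>"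
  shows "L2_dist \<mu> (L2_class \<mu> f) (L2_class \<mu> g) = sqrt (\<integral>x. (f x - g x)\<^sup>2 \<partial>\<mu>)"
proof -
  have sq: "L2_rep (L2_class \<mu> f) \<in> square_integrable \<mu>" "L2_rep (L2_class \<mu> g) \<in> square_integrable \<mu>"
    using f g L2_rep(1) L2_class_in_L2 by blast+
  have "(\<integral>x. (L2_rep (L2_class \<mu> f) x - L2_rep (L2_class \<mu> g) x)\<^sup>2 \<partial>\<mu>) = (\<integral>x. (f x - g x)\<^sup>2 \<partial>\<mu>)"
  proof (rule integral_cong_AE)
    show "AE x in \<mu>. (L2_rep (L2_class \<mu> f) x - L2_rep (L2_class \<mu> g) x)\<^sup>2 = (f x - g x)\<^sup>2"
      using L2_class_rep[OF f] L2_class_rep[OF g] by eventually_elim simp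
  qed (use sq f g in \<open>auto simp: square_integrable_def\<close>)
  then show ?thesis
    by (simp add: L2_dist_eq L2_class_in_L2 f g)
qed

section \<open>Orthonormal expansions\<close>

text \<open>Isolates what the algebra of coefficients rests on; density of the span is brought in
  for truncation.\<close>

definition orthonormal_L2 :: "'a measure \<Rightarrow> (nat \<Rightarrow> 'a \<Rightarrow> real) \<Rightarrow> bool" where
  "orthonormal_L2 \<mu> \<phi> \<longleftrightarrow>
     (\<forall>i. \<phi> i \<in> square_integrable \<mu>) \<and>
     (\<forall>i j. (\<integral>x. \<phi> i x * \<phi> j x \<partial>\<mu>) = (if i = j then 1 else 0))"

lemma orthonormal_basis_L2_imp_orthonormal_L2:
  "orthonormal_basis_L2 \<mu> \<phi> \<Longrightarrow> orthonormal_L2 \<mu> \<phi>"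
  unfolding orthonormal_basis_L2_def orthonormal_L2_def by (metis L2_inner_class)

text \<open>Taking for \<open>c\<close> the coefficients of \<open>f\<close> gives Bessel's inequality and shows that they are the
  best choice; taking \<open>f = 0\<close> gives the isometry of the decoder.\<close>

lemma integral_sq_diff_lincomb:
  fixes N :: nat
  assumes on: "orthonormal_L2 \<mu> \<phi>" and f: "f \<in> square_integrable \<mu>"
  shows "(\<integral>x. (f x - (\<Sum>i<N. c i * \<phi> i x))\<^sup>2 \<partial>\<mu>) =
    (\<integral>x. (f x)\<^sup>2 \<partial>\<mu>) - (\<Sum>i<N. (\<integral>x. f x * \<phi> i x \<partial>\<mu>)\<^sup>2) + (\<Sum>i<N. (c i - (\<integral>x. f x * \<phi> i x \<partial>\<mu>))\<^sup>2)"
proof (induction N)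
  case (Suc N)
  define S where "S = (\<lambda>x. \<Sum>i<N. c i * \<phi> i x)"
  define \<alpha> where "\<alpha> = (\<integral>x. f x * \<phi> N x \<partial>\<mu>)"
  have \<phi>: "\<phi> i \<in> square_integrable \<mu>" for i
    using on by (simp add: orthonormal_L2_def)
  have S: "S \<in> square_integrable \<mu>"
    unfolding S_def by (rule square_integrable_lincomb) (rule \<phi>)
  \<comment> \<open>\<open>S\<close> involves only indices below \<open>N\<close>, so it is
    orthogonal to \<open>\<phi> N\<close>, and \<open>f - S\<close> has the same coefficient at
    \<open>N\<close> as \<open>f\<close>.\<close>
  have "(\<integral>x. S x * \<phi> N x \<partial>\<mu>) = (\<Sum>i<N. c i * (\<integral>x. \<phi> i x * \<phi> N x \<partial>\<mu>))"
    using square_integrable_prod[OF \<phi> \<phi>]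
    by (simp add: S_def sum_distrib_right mult.assoc Bochner_Integration.integral_sum)
  also have "\<dots> = 0"
    using on by (intro sum.neutral) (auto simp: orthonormal_L2_def)
  finally have S0: "(\<integral>x. S x * \<phi> N x \<partial>\<mu>) = 0" .
  have cross: "(\<integral>x. (f x - S x) * \<phi> N x \<partial>\<mu>) = \<alpha>"
    using square_integrable_prod[OF f \<phi>] square_integrable_prod[OF S \<phi>]
    by (simp add: left_diff_distrib S0 \<alpha>_def)
  have int: "integrable \<mu> (\<lambda>x. (f x - S x)\<^sup>2)" "integrable \<mu> (\<lambda>x. (f x - S x) * \<phi> N x)"
      "integrable \<mu> (\<lambda>x. (\<phi> N x)\<^sup>2)"
    using square_integrable_diff[OF f S] square_integrable_prod[OF square_integrable_diff[OF f S] \<phi>] \<phi>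
    by (auto simp: square_integrable_def)
  have "(\<integral>x. (f x - (\<Sum>i<Suc N. c i * \<phi> i x))\<^sup>2 \<partial>\<mu>) =
      (\<integral>x. (f x - S x)\<^sup>2 - 2 * c N * ((f x - S x) * \<phi> N x) + (c N)\<^sup>2 * (\<phi> N x)\<^sup>2 \<partial>\<mu>)"
    by (rule Bochner_Integration.integral_cong)
      (simp_all add: S_def power2_eq_square algebra_simps)
  also have "\<dots> = (\<integral>x. (f x - S x)\<^sup>2 \<partial>\<mu>) - 2 * c N * (\<integral>x. (f x - S x) * \<phi> N x \<partial>\<mu>)
      + (c N)\<^sup>2 * (\<integral>x. (\<phi> N x)\<^sup>2 \<partial>\<mu>)"
    using int by simp
  \<comment> \<open>Completing the square in \<open>c N\<close>, as \<open>\<phi> N\<close> has norm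
    1.\<close>
  also have "\<dots> = (\<integral>x. (f x - S x)\<^sup>2 \<partial>\<mu>) - \<alpha>\<^sup>2 + (c N - \<alpha>)\<^sup>2"
    unfolding cross using on
    by (simp add: orthonormal_L2_def power2_eq_square right_diff_distrib left_diff_distrib)
  finally show ?case
    using Suc.IH by (simp add: S_def \<alpha>_def)
qed simp

section \<open>Metric properties of encoder and decoder\<close>

lemma encoder_eq_integral:
  assumes "orthonormal_L2 \<mu> \<phi>" "a \<in> L2 \<mu>" "i < d"
  shows "encoder \<mu> \<phi> d a i = (\<integral>x. L2_rep a x * \<phi> i x \<partial>\<mu>)"
  using assms L2_inner_class[of "L2_rep a" \<mu> "\<phi> i"] L2_rep[of a \<mu>]
  by (simp add: encoder_def orthonormal_L2_def)

lemma decoder_in_L2: "orthonormal_L2 \<mu> \<phi> \<Longrightarrow> decoder \<mu> \<phi> d \<beta> \<in> L2 \<mu>"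
  unfolding decoder_def orthonormal_L2_def by (intro L2_class_in_L2 square_integrable_lincomb) auto

lemma L2_dist_decoder_right:
  assumes on: "orthonormal_L2 \<mu> \<phi>" and a: "a \<in> L2 \<mu>"
  shows "L2_dist \<mu> a (decoder \<mu> \<phi> d c) = sqrt ((\<integral>x. (L2_rep a x)\<^sup>2 \<partial>\<mu>)
    - (\<Sum>i<d. (encoder \<mu> \<phi> d a i)\<^sup>2) + (\<Sum>i<d. (c i - encoder \<mu> \<phi> d a i)\<^sup>2))"
proof -
  have "L2_dist \<mu> (L2_class \<mu> (L2_rep a)) (decoder \<mu> \<phi> d c)
      = sqrt (\<integral>x. (L2_rep a x - (\<Sum>i<d. c i * \<phi> i x))\<^sup>2 \<partial>\<mu>)"
    unfolding decoder_def using on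
    by (intro L2_dist_class L2_rep(1)[OF a] square_integrable_lincomb)
      (auto simp: orthonormal_L2_def)
  then show ?thesis
    by (simp add: L2_rep(2)[OF a] integral_sq_diff_lincomb[OF on L2_rep(1)[OF a]]
        encoder_eq_integral[OF on a])
qed

text \<open>In the distance formula \<open>c\<close> enters only through a sum of squares, which
  vanishes when \<open>c\<close> is the encoding of \<open>a\<close>.\<close>

lemma decoder_encoder_best_approximation:
  assumes "orthonormal_L2 \<mu> \<phi>" "a \<in> L2 \<mu>"
  shows "L2_dist \<mu> a (decoder \<mu> \<phi> d (encoder \<mu> \<phi> d a)) \<le> L2_dist \<mu> a (decoder \<mu> \<phi> d c)"
  by (simp add: L2_dist_decoder_right[OF assms] sum_nonneg)

text \<open>Carries the Euclidean error of the network over to the function space.\<close>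

lemma decoder_isometry:
  assumes on: "orthonormal_L2 \<mu> \<phi>"
  shows "L2_dist \<mu> (decoder \<mu> \<phi> d b) (decoder \<mu> \<phi> d c) = L2_set (\<lambda>i. b i - c i) {..<d}"
proof -
  have sq: "(\<lambda>x. \<Sum>i<d. e i * \<phi> i x) \<in> square_integrable \<mu>" for e
    using on by (intro square_integrable_lincomb) (auto simp: orthonormal_L2_def)
  have "L2_dist \<mu> (decoder \<mu> \<phi> d b) (decoder \<mu> \<phi> d c) =
      sqrt (\<integral>x. (0 - (\<Sum>i<d. (c i - b i) * \<phi> i x))\<^sup>2 \<partial>\<mu>)"
    by (simp add: decoder_def L2_dist_class[OF sq sq] left_diff_distrib sum_subtractf power2_commute)
  also have "\<dots> = sqrt (\<Sum>i<d. (c i - b i)\<^sup>2)"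
    by (subst integral_sq_diff_lincomb[OF on square_integrable_0]) simp
  finally show ?thesis
    by (simp add: L2_set_def power2_commute)
qed

lemma encoder_nonexpansive:
  assumes on: "orthonormal_L2 \<mu> \<phi>" and a: "a \<in> L2 \<mu>" and b: "b \<in> L2 \<mu>"
  shows "L2_set (\<lambda>i. encoder \<mu> \<phi> d a i - encoder \<mu> \<phi> d b i) {..<d} \<le> L2_dist \<mu> a b"
proof -
  define f where "f = (\<lambda>x. L2_rep a x - L2_rep b x)"
  have f: "f \<in> square_integrable \<mu>"
    unfolding f_def by (intro square_integrable_diff L2_rep(1) a b)
  have "encoder \<mu> \<phi> d a i - encoder \<mu> \<phi> d b i = (\<integral>x. f x * \<phi> i x \<partial>\<mu>)" if "i < d" for i
    using on square_integrable_prod[OF L2_rep(1)[OF a], of "\<phi> i"]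
      square_integrable_prod[OF L2_rep(1)[OF b], of "\<phi> i"] that
    by (simp add: encoder_eq_integral[OF on] a b f_def left_diff_distrib orthonormal_L2_def)
  then have "(\<Sum>i<d. (encoder \<mu> \<phi> d a i - encoder \<mu> \<phi> d b i)\<^sup>2) = (\<Sum>i<d. (\<integral>x. f x * \<phi> i x \<partial>\<mu>)\<^sup>2)"
    by simp
  \<comment> \<open>Bessel's inequality for \<open>f\<close>: the squared residual of its own
    expansion is non-negative.\<close>
  moreover have "0 \<le> (\<integral>x. (f x - (\<Sum>i<d. (\<integral>x. f x * \<phi> i x \<partial>\<mu>) * \<phi> i x))\<^sup>2 \<partial>\<mu>)"
    by simp
  ultimately have "(\<Sum>i<d. (encoder \<mu> \<phi> d a i - encoder \<mu> \<phi> d b i)\<^sup>2) \<le> (\<integral>x. (f x)\<^sup>2 \<partial>\<mu>)"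
    unfolding integral_sq_diff_lincomb[OF on f] by simp
  then show ?thesis
    by (simp add: L2_set_def L2_dist_eq[OF a b] f_def)
qed

section \<open>Continuity of encoder, decoder and operator\<close>

lemma topspace_L2_topology: "topspace (L2_topology \<mu>) = L2 \<mu>"
  by (simp add: L2_topology_def Metric_space.topspace_mtopology[OF Metric_space_L2])

text \<open>Continuity may be checked coordinatewise, and each coordinate is 1-Lipschitz because it
  is bounded by the Euclidean norm.\<close>

lemma continuous_map_encoder:
  assumes on: "orthonormal_L2 \<mu> \<phi>"
  shows "continuous_map (L2_topology \<mu>) (Euclidean_space d) (encoder \<mu> \<phi> d)"
proof -
  interpret Metric_space "L2 \<mu>" "L2_dist \<mu>" by (rule Metric_space_L2)
  have "continuous_map (L2_topology \<mu>) euclideanreal (\<lambda>a. L2_inner \<mu> a (L2_class \<mu> (\<phi> i)))"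
    if "i < d" for i
  proof -
    have "\<bar>L2_inner \<mu> a (L2_class \<mu> (\<phi> i)) - L2_inner \<mu> b (L2_class \<mu> (\<phi> i))\<bar> \<le> L2_dist \<mu> a b"
      if ab: "a \<in> L2 \<mu>" "b \<in> L2 \<mu>" for a b
      using member_le_L2_set[of "{..<d}" i "\<lambda>i. \<bar>encoder \<mu> \<phi> d a i - encoder \<mu> \<phi> d b i\<bar>"]
        encoder_nonexpansive[OF on ab, of d] \<open>i < d\<close>
      by (simp add: encoder_def L2_set_def)
    then have "Lipschitz_continuous_map (Abstract_Metric_Spaces.metric (L2 \<mu>, L2_dist \<mu>)) euclidean_metric
        (\<lambda>a. L2_inner \<mu> a (L2_class \<mu> (\<phi> i)))"
      unfolding Lipschitz_continuous_map_def by (auto simp: dist_real_def intro!: exI[of _ 1])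
    from Lipschitz_continuous_imp_continuous_map[OF this] show ?thesis
      by (simp add: L2_topology_def)
  qed
  then have "continuous_map (L2_topology \<mu>) (Euclidean_space d)
      (\<lambda>a i. if i < d then L2_inner \<mu> a (L2_class \<mu> (\<phi> i)) else 0)"
    by (simp add: continuous_map_componentwise_Euclidean_space)
  then show ?thesis
    by (simp add: encoder_def[abs_def])
qed

lemma continuous_map_decoder:
  assumes on: "orthonormal_L2 \<mu> \<phi>"
  shows "continuous_map (Euclidean_space d) (L2_topology \<mu>) (decoder \<mu> \<phi> d)"
proof -
  interpret Metric_space "L2 \<mu>" "L2_dist \<mu>" by (rule Metric_space_L2)
  show ?thesis
    unfolding L2_topology_def continuous_map_to_metric
  proof (intro ballI allI impI)
    fix x and r :: real
    assume x: "x \<in> topspace (Euclidean_space d)" and r: "r > 0"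
    \<comment> \<open>\<open>Euclidean_space\<close> is given by a product topology, not by a
      metric, so the neighbourhood of \<open>x\<close> is a preimage under the continuous function
      \<open>h\<close>, the distance from \<open>x\<close>.\<close>
    define h where "h = (\<lambda>y. L2_set (\<lambda>i. x i - y i) {..<d})"
    have "continuous_map (Euclidean_space d) euclideanreal h"
      unfolding h_def L2_set_def Euclidean_space_def by (intro continuous_intros) auto
    from openin_continuous_map_preimage[OF this, of "{..<r}"]
    have "openin (Euclidean_space d) {y \<in> topspace (Euclidean_space d). h y \<in> {..<r}}"
      by simp
    moreover have "x \<in> {y \<in> topspace (Euclidean_space d). h y \<in> {..<r}}"
      using x r by (simp add: h_def L2_set_def)
    ultimately show "\<exists>U. openin (Euclidean_space d) U \<and> x \<in> U \<and>
        (\<forall>y\<in>U. decoder \<mu> \<phi> d y \<in> mball (decoder \<mu> \<phi> d x) r)"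
      by (intro exI[of _ "{y \<in> topspace (Euclidean_space d). h y \<in> {..<r}}"])
        (auto simp: decoder_in_L2[OF on] decoder_isometry[OF on] h_def)
  qed
qed

lemma lipschitz_operator_continuous_map:
  assumes "G \<in> L2 \<mu> \<rightarrow> L2 \<nu>" "lipschitz_operator \<mu> \<nu> G"
  shows "continuous_map (L2_topology \<mu>) (L2_topology \<nu>) G"
proof -
  interpret X: Metric_space "L2 \<mu>" "L2_dist \<mu>" by (rule Metric_space_L2)
  interpret Y: Metric_space "L2 \<nu>" "L2_dist \<nu>" by (rule Metric_space_L2)
  have "Lipschitz_continuous_map (Abstract_Metric_Spaces.metric (L2 \<mu>, L2_dist \<mu>)) (Abstract_Metric_Spaces.metric (L2 \<nu>, L2_dist \<nu>)) G"
    using assms unfolding Lipschitz_continuous_map_def lipschitz_operator_def by auto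
  from Lipschitz_continuous_imp_continuous_map[OF this] show ?thesis
    by (simp add: L2_topology_def)
qed

section \<open>Uniform truncation on compact sets\<close>

text \<open>A finite \<open>e / 2\<close>-net of \<open>K\<close> is approximated within
  \<open>e / 2\<close> by finite linear combinations. The largest of their lengths serves all of
  \<open>K\<close>, since the encoding gives the best approximation of that length.\<close>

lemma uniform_truncation_on_compact:
  assumes basis: "orthonormal_basis_L2 \<mu> \<phi>" and K: "compactin (L2_topology \<mu>) K" and e: "e > 0"
  obtains d where "d \<ge> 1" "\<And>a. a \<in> K \<Longrightarrow> L2_dist \<mu> a (decoder \<mu> \<phi> d (encoder \<mu> \<phi> d a)) \<le> e"
proof -
  interpret Metric_space "L2 \<mu>" "L2_dist \<mu>" by (rule Metric_space_L2)
  have on: "orthonormal_L2 \<mu> \<phi>"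
    using basis by (rule orthonormal_basis_L2_imp_orthonormal_L2)
  have K_L2: "K \<subseteq> L2 \<mu>"
    using compactin_subset_topspace[OF K] by (simp add: topspace_L2_topology)
  have "mtotally_bounded K"
    using K compactin_imp_mtotally_bounded by (simp add: L2_topology_def)
  then obtain T where T: "finite T" "T \<subseteq> K" "K \<subseteq> (\<Union>x\<in>T. mball x (e / 2))"
    using e unfolding mtotally_bounded_def by (meson half_gt_zero)
  have "\<exists>N c. L2_dist \<mu> t (decoder \<mu> \<phi> N c) < e / 2" if "t \<in> T" for t
  proof -
    have "t \<in> mtopology closure_of L2_span \<mu> \<phi>"
      using basis that T(2) K_L2 unfolding orthonormal_basis_L2_def L2_topology_def by auto
    then obtain s where "s \<in> L2_span \<mu> \<phi>" "s \<in> mball t (e / 2)"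
      using e unfolding metric_closure_of by (auto dest!: spec[of _ "e / 2"])
    then show ?thesis
      unfolding L2_span_def decoder_def by auto
  qed
  then obtain N c where Nc: "\<And>t. t \<in> T \<Longrightarrow> L2_dist \<mu> t (decoder \<mu> \<phi> (N t) (c t)) < e / 2"
    by metis
  \<comment> \<open>Inserting 1 keeps \<open>d\<close> positive, even for empty \<open>T\<close>;
    networks are given only for positive dimensions.\<close>
  define d where "d = Max (insert 1 (N ` T))"
  show ?thesis
  proof (rule that)
    show "d \<ge> 1"
      unfolding d_def using T(1) by (intro Max_ge) auto
    fix a assume a: "a \<in> K"
    then obtain t where t: "t \<in> T" "a \<in> mball t (e / 2)"
      using T(3) by blast
    \<comment> \<open>Padding with zeros brings the combination for \<open>t\<close> to the common
      length \<open>d\<close>.\<close>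
    define c' where "c' = (\<lambda>i. if i < N t then c t i else 0)"
    have "N t \<le> d"
      unfolding d_def using T(1) t(1) by (intro Max_ge) auto
    then have "(\<Sum>i<d. c' i * \<phi> i x) = (\<Sum>i<N t. c t i * \<phi> i x)" for x
      unfolding c'_def by (intro sum.mono_neutral_cong_right) auto
    then have eq: "decoder \<mu> \<phi> d c' = decoder \<mu> \<phi> (N t) (c t)"
      by (simp add: decoder_def)
    have "L2_dist \<mu> a (decoder \<mu> \<phi> d (encoder \<mu> \<phi> d a)) \<le> L2_dist \<mu> a (decoder \<mu> \<phi> d c')"
      using a K_L2 by (intro decoder_encoder_best_approximation[OF on]) auto
    also have "\<dots> \<le> L2_dist \<mu> a t + L2_dist \<mu> t (decoder \<mu> \<phi> (N t) (c t))"
      unfolding eq using t(2) by (intro triangle decoder_in_L2[OF on]) auto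
    also have "\<dots> \<le> e"
      using Nc[OF t(1)] t(2) commute[of a t] by simp
    finally show "L2_dist \<mu> a (decoder \<mu> \<phi> d (encoder \<mu> \<phi> d a)) \<le> e" .
  qed
qed

section \<open>Approximation of the operator\<close>

lemma neural_operator_approximation:
  fixes \<mu> :: "'a measure" and \<nu> :: "'b measure"
  assumes \<phi>: "orthonormal_basis_L2 \<mu> \<phi>" and \<psi>: "orthonormal_basis_L2 \<nu> \<psi>"
    and F: "\<And>m n. m \<ge> 1 \<Longrightarrow> n \<ge> 1 \<Longrightarrow> universal_approximation m n (F m n)"
    and G: "G \<in> L2 \<mu> \<rightarrow> L2 \<nu>" "lipschitz_operator \<mu> \<nu> G"
    and K: "compactin (L2_topology \<mu>) K" and \<epsilon>: "\<epsilon> > 0"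
  obtains m n R where "m \<ge> 1" "n \<ge> 1" "R \<in> F m n"
    "\<And>a. a \<in> K \<Longrightarrow> L2_dist \<nu> (G a) ((decoder \<nu> \<psi> n \<circ> R \<circ> encoder \<mu> \<phi> m) a) \<le> \<epsilon>"
proof -
  interpret Y: Metric_space "L2 \<nu>" "L2_dist \<nu>" by (rule Metric_space_L2)
  have on: "orthonormal_L2 \<mu> \<phi>" "orthonormal_L2 \<nu> \<psi>"
    using \<phi> \<psi> orthonormal_basis_L2_imp_orthonormal_L2 by blast+
  note in_L2 = decoder_in_L2[OF on(1)] decoder_in_L2[OF on(2)]
  have G_in: "G a \<in> L2 \<nu>" if "a \<in> L2 \<mu>" for a
    using G(1) that by auto
  have G_cont: "continuous_map (L2_topology \<mu>) (L2_topology \<nu>) G"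
    by (rule lipschitz_operator_continuous_map[OF G])
  obtain M where M: "M > 0"
    "\<And>a b. a \<in> L2 \<mu> \<Longrightarrow> b \<in> L2 \<mu> \<Longrightarrow> L2_dist \<nu> (G a) (G b) \<le> M * L2_dist \<mu> a b"
    using G(2) unfolding lipschitz_operator_def by blast
  \<comment> \<open>The Lipschitz constant \<open>M\<close> turns this tolerance into
    \<open>\<epsilon> / 3\<close>, one of three equal shares of the error.\<close>
  have "\<epsilon> / (3 * M) > 0"
    using \<epsilon> M(1) by simp
  then obtain m where m: "m \<ge> 1"
    "\<And>a. a \<in> K \<Longrightarrow> L2_dist \<mu> a (decoder \<mu> \<phi> m (encoder \<mu> \<phi> m a)) \<le> \<epsilon> / (3 * M)"
    using uniform_truncation_on_compact[OF \<phi> K] by blast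
  have "compactin (L2_topology \<nu>) (G ` K)"
    by (rule image_compactin[OF K G_cont])
  moreover have "\<epsilon> / 3 > 0"
    using \<epsilon> by simp
  ultimately obtain n where n: "n \<ge> 1"
    "\<And>b. b \<in> G ` K \<Longrightarrow> L2_dist \<nu> b (decoder \<nu> \<psi> n (encoder \<nu> \<psi> n b)) \<le> \<epsilon> / 3"
    using uniform_truncation_on_compact[OF \<psi>] by blast
  define f where "f = encoder \<nu> \<psi> n \<circ> (G \<circ> decoder \<mu> \<phi> m)"
  have "f \<in> C_Rn m n"
    unfolding C_Rn_def f_def
    using continuous_map_compose[OF continuous_map_compose[OF continuous_map_decoder[OF on(1)] G_cont]
        continuous_map_encoder[OF on(2)]] by simp
  moreover have "compactin (Euclidean_space m) (encoder \<mu> \<phi> m ` K)"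
    by (rule image_compactin[OF K continuous_map_encoder[OF on(1)]])
  ultimately obtain R where R: "R \<in> F m n"
    "(SUP x\<in>encoder \<mu> \<phi> m ` K. ereal (L2_set (\<lambda>i. f x i - R x i) {..<n})) \<le> ereal (\<epsilon> / 3)"
    using F[OF m(1) n(1)] \<open>\<epsilon> / 3 > 0\<close> unfolding universal_approximation_def by blast
  show ?thesis
  proof (rule that[OF m(1) n(1) R(1)])
    fix a assume a: "a \<in> K"
    then have a_L2: "a \<in> L2 \<mu>"
      using compactin_subset_topspace[OF K] by (auto simp: topspace_L2_topology)
    define x where "x = encoder \<mu> \<phi> m a"
    define a' where "a' = decoder \<mu> \<phi> m x"
    have a'_L2: "a' \<in> L2 \<mu>"
      by (simp add: a'_def in_L2)
    have fx: "f x = encoder \<nu> \<psi> n (G a')"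
      by (simp add: f_def a'_def)
    \<comment> \<open>Replacing \<open>a\<close> by its truncation \<open>a'\<close> costs no more
      after encoding and decoding than before.\<close>
    have "L2_dist \<nu> (decoder \<nu> \<psi> n (encoder \<nu> \<psi> n (G a))) (decoder \<nu> \<psi> n (f x)) \<le> L2_dist \<nu> (G a) (G a')"
      unfolding decoder_isometry[OF on(2)] fx
      by (intro encoder_nonexpansive[OF on(2)] G_in a_L2 a'_L2)
    also have "\<dots> \<le> M * (\<epsilon> / (3 * M))"
      using M(2)[OF a_L2 a'_L2] m(2)[OF a] M(1) unfolding a'_def x_def
      by (meson dual_order.trans mult_left_mono less_imp_le)
    finally have 2: "L2_dist \<nu> (decoder \<nu> \<psi> n (encoder \<nu> \<psi> n (G a))) (decoder \<nu> \<psi> n (f x)) \<le> \<epsilon> / 3"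
      using M(1) by simp
    \<comment> \<open>The network bound applies because \<open>x\<close> lies in the encoded image
      of \<open>K\<close>.\<close>
    have 3: "L2_dist \<nu> (decoder \<nu> \<psi> n (f x)) (decoder \<nu> \<psi> n (R x)) \<le> \<epsilon> / 3"
      using R(2) a unfolding decoder_isometry[OF on(2)] by (simp add: SUP_le_iff x_def)
    have 1: "L2_dist \<nu> (G a) (decoder \<nu> \<psi> n (encoder \<nu> \<psi> n (G a))) \<le> \<epsilon> / 3"
      using n(2) a by blast
    have "L2_dist \<nu> (G a) (decoder \<nu> \<psi> n (R x)) \<le> \<epsilon> / 3 + (\<epsilon> / 3 + \<epsilon> / 3)"
      using 1 2 3 Y.triangle[OF G_in[OF a_L2] in_L2(2) in_L2(2)] Y.triangle[OF in_L2(2) in_L2(2) in_L2(2)]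
      by (smt (verit))
    then show "L2_dist \<nu> (G a) ((decoder \<nu> \<psi> n \<circ> R \<circ> encoder \<mu> \<phi> m) a) \<le> \<epsilon>"
      by (simp add: x_def)
  qed
qed

theorem mainTheorem1:
  fixes X :: "'a manifold" and Y :: "'b manifold"
    and ev_X ev_Y :: "nat \<Rightarrow> real"
    and \<phi>_X :: "nat \<Rightarrow> 'a \<Rightarrow> real" and \<phi>_Y :: "nat \<Rightarrow> 'b \<Rightarrow> real"
    and F :: "nat \<Rightarrow> nat \<Rightarrow> ((nat \<Rightarrow> real) \<Rightarrow> (nat \<Rightarrow> real)) set"
    and G :: "('a \<Rightarrow> real) set \<Rightarrow> ('b \<Rightarrow> real) set"
    and K :: "('a \<Rightarrow> real) set set"
    and \<epsilon> :: real
  assumes "riemannian_manifold X" and "riemannian_manifold Y"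
    and "LBO_eigenbasis X ev_X \<phi>_X" and "LBO_eigenbasis Y ev_Y \<phi>_Y"
    and "\<And>m n. m \<ge> 1 \<Longrightarrow> n \<ge> 1 \<Longrightarrow> F m n \<subseteq> C_Rn m n \<and> universal_approximation m n (F m n)"
    and "G \<in> L2 (riemannian_volume X) \<rightarrow> L2 (riemannian_volume Y)"
    and "lipschitz_operator (riemannian_volume X) (riemannian_volume Y) G"
    and "compactin (L2_topology (riemannian_volume X)) K"
    and "\<epsilon> > 0"
  shows "\<exists>d_X\<ge>1. \<exists>d_Y\<ge>1. \<exists>R\<in>F d_X d_Y.
    (SUP a\<in>K. ereal (L2_norm (riemannian_volume Y) (L2_diff (riemannian_volume Y) (G a)
       ((decoder (riemannian_volume Y) \<phi>_Y d_Y \<circ> R \<circ>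
         encoder (riemannian_volume X) \<phi>_X d_X) a)))) \<le> ereal \<epsilon>"
proof -
  have "orthonormal_basis_L2 (riemannian_volume X) \<phi>_X" "orthonormal_basis_L2 (riemannian_volume Y) \<phi>_Y"
    using assms(3,4) by (simp_all add: LBO_eigenbasis_def)
  from neural_operator_approximation[OF this _ assms(6-9), of F] assms(5)
  obtain m n R where "m \<ge> 1" "n \<ge> 1" "R \<in> F m n"
    "\<And>a. a \<in> K \<Longrightarrow> L2_dist (riemannian_volume Y) (G a)
       ((decoder (riemannian_volume Y) \<phi>_Y n \<circ> R \<circ> encoder (riemannian_volume X) \<phi>_X m) a) \<le> \<epsilon>"
    by blast
  then show ?thesis
    \<comment> \<open>The supremum is taken in \<open>ereal\<close>, so the pointwise bound suffices
      even for empty \<open>K\<close>.\<close>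
    by (intro exI[of _ m] exI[of _ n] conjI bexI[of _ R] SUP_least) auto
qed

end
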